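(* Let $X,Z$ be real normed spaces, $K\subset X$ a closed convex pointed cone, $F:Z\rightrightarrows X$ a set-valued map, and $\overline z\in Z$. Suppose that $F$ is $K$-Lipschitz around $\overline z$ with constant $\ell>0$ and element $e\in S_X\cap K$, that $F(z)$ is weakly $K$-compact for every $z\in Z$, and that $K$ is normal. Then there is $\alpha>0$ such that for all $T\in\widehat\partial F(\overline z)$ and all $u\in S_Z\cap T^{-1}\bigl(K\cup(-K)\bigr)$ one has $$\|Tu\|\leq\alpha\,\ell\,\|e\|.$$
   Context: $S_X,S_Z$ are the unit spheres of $X,Z$; $D_X$ is the closed unit ball of $X$; $B(Z,X)$ is the space of bounded linear operators from $Z$ to $X$. A cone $K$ is pointed if $K\cap(-K)=\{0\}$. $F$ is $K$-Lipschitz around $\overline z$ with constant $\ell>0$ and element $e\in S_X\cap K$ if there is a neighborhood $U$ of $\overline z$ such that for all $z',z''\in U$, $F(z'')+\ell\|z''-z'\|e\subset F(z')+K$. A nonempty set $A\subset X$ is weakly $K$-compact if from every cover of $A$ by sets of the form $U+K$, with $U\subset X$ weakly open, one can extract a finite subcover. The cone $K$ is normal iff there exists $\alpha>0$ such that $\|z\|\le\alpha\|y\|$ whenever $z,y\in K$ and $y-z\in K$. With $\operatorname{Epi}F(z)=F(z)+K$ and the excess $e(A,B)=\sup_{x\in A}d(x,B)$, the Fréchet subdifferential of $F$ at $\overline z$ is $$\widehat\partial F(\overline z)=\Bigl\{T\in B(Z,X)\ \Big|\ \lim_{z\to\overline z}\frac{e\bigl(\operatorname{Epi}F(z),\operatorname{Epi}F(\overline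 z)+T(z-\overline z)\bigr)}{\|z-\overline z\|}=0\Bigr\};$$ equivalently, $T\in\widehat\partial F(\overline z)$ iff $T\in B(Z,X)$ and for every $\varepsilon>0$ there is $\delta>0$ such that for all $z\in Z$ with $\|z-\overline z\|<\delta$, $\operatorname{Epi}F(z)\subset\operatorname{Epi}F(\overline z)+T(z-\overline z)+\varepsilon\|z-\overline z\|D_X$. *)

theory Defs
  imports "HOL-Analysis.Analysis"
begin

text \<open>Sums of sets are Minkowski sums, from \<^theory>\<open>HOL-Library.Set_Algebras\<close>.\<close>

definition pointed :: "'a::real_vector set \<Rightarrow> bool" where
  "pointed K \<longleftrightarrow> K \<inter> uminus ` K = {0}"

definition normal_cone :: "'a::real_normed_vector set \<Rightarrow> bool" where
  "normal_cone K \<longleftrightarrow>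
     (\<exists>\<alpha>>0. \<forall>z\<in>K. \<forall>y\<in>K. y - z \<in> K \<longrightarrow> norm z \<le> \<alpha> * norm y)"

definition K_Lipschitz_around ::
  "'x::real_normed_vector set \<Rightarrow> ('z::real_normed_vector \<Rightarrow> 'x set) \<Rightarrow> 'z \<Rightarrow> real \<Rightarrow> 'x \<Rightarrow> bool" where
  "K_Lipschitz_around K F zbar l e \<longleftrightarrow>
     l > 0 \<and> e \<in> sphere 0 1 \<inter> K \<and>
     (\<exists>U. open U \<and> zbar \<in> U \<and>
        (\<forall>z'\<in>U. \<forall>z''\<in>U. F z'' + {(l * norm (z'' - z')) *\<^sub>R e} \<subseteq> F z' + K))"

text \<open>The weak topology: the coarsest one making every continuous linear functional continuous.\<close>

definition weak_topology :: "'a::real_normed_vector topology" where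
  "weak_topology = topology_generated_by
     {f -` V | (f :: 'a \<Rightarrow> real) V. bounded_linear f \<and> open V}"

definition weakly_K_compact :: "'a::real_normed_vector set \<Rightarrow> 'a set \<Rightarrow> bool" where
  "weakly_K_compact K A \<longleftrightarrow> A \<noteq> {} \<and>
     (\<forall>\<U>. (\<forall>U\<in>\<U>. openin weak_topology U) \<and> A \<subseteq> (\<Union>U\<in>\<U>. U + K) \<longrightarrow>
        (\<exists>\<V>. finite \<V> \<and> \<V> \<subseteq> \<U> \<and> A \<subseteq> (\<Union>U\<in>\<V>. U + K)))"

definition Epi :: "'x::real_normed_vector set \<Rightarrow> ('z \<Rightarrow> 'x set) \<Rightarrow> 'z \<Rightarrow> 'x set" where
  "Epi K F z = F z + K"

text \<open>The excess takes values in \<open>[0, \<infinity>]\<close>, with the usual conventions that the supremum over the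
  empty set is \<open>0\<close> and the distance to the empty set is \<open>\<infinity>\<close>. (The library's \<^const>\<open>infdist\<close> would
  instead give \<open>0\<close> for the latter.)\<close>

definition excess :: "'a::metric_space set \<Rightarrow> 'a set \<Rightarrow> ennreal" where
  "excess A B = (SUP x\<in>A. INF y\<in>B. ennreal (dist x y))"

definition frechet_subdifferential ::
  "'x::real_normed_vector set \<Rightarrow> ('z::real_normed_vector \<Rightarrow> 'x set) \<Rightarrow> 'z \<Rightarrow> ('z \<Rightarrow>\<^sub>L 'x) set" where
  "frechet_subdifferential K F zbar =
     {T. ((\<lambda>z. excess (Epi K F z) (Epi K F zbar + {blinfun_apply T (z - zbar)})
               / ennreal (norm (z - zbar))) \<longlongrightarrow> 0) (at zbar)}"

end

theory Submission
  imports Defs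
begin

text \<open>Let \<open>f\<close> be a continuous functional that is nonnegative on \<open>K\<close>. Weak \<open>K\<close>-compactness of
  \<open>F zbar\<close> bounds \<open>f\<close> from below there. The Lipschitz condition and the subgradient inequality at
  \<open>zbar + t u\<close> give \<open>F zbar + t (l e - T u) \<subseteq> F zbar + K + \<epsilon> t D\<close> for small \<open>t > 0\<close>, and comparing the
  infima of \<open>f\<close> on both sides yields \<open>f (l e - T u) \<ge> 0\<close>. By Hahn--Banach separation
  \<open>l e - T u \<in> K\<close> for every unit vector \<open>u\<close>. Normality of \<open>K\<close> bounds \<open>T u\<close> when \<open>T u \<in> K\<close>; when
  \<open>- T u \<in> K\<close>, the same argument applies to \<open>- u\<close>.\<close>

section \<open>Sublinear functionals and the Hahn--Banach theorem\<close>

definition sublinear :: "('a::real_vector \<Rightarrow> real) \<Rightarrow> bool" where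
  "sublinear p \<longleftrightarrow>
     (\<forall>x y. p (x + y) \<le> p x + p y) \<and> (\<forall>c\<ge>0. \<forall>x. p (c *\<^sub>R x) = c * p x)"

text \<open>Applying \<open>scale\<close> with factor \<open>inverse c\<close> at
  \<open>c *\<^sub>R x\<close> gives the reverse inequality. Factor 1/2 at the origin, together with
  subadditivity, forces \<open>p 0 = 0\<close>.\<close>

lemma sublinearI:
  assumes add: "\<And>x y. p (x + y) \<le> p x + p y"
    and scale: "\<And>c x. c > 0 \<Longrightarrow> p (c *\<^sub>R x) \<le> c * p x"
  shows "sublinear p"
proof -
  have "p 0 = 0"
    using add[of 0 0] scale[of "1/2" 0] by simp
  moreover have "p (c *\<^sub>R x) = c * p x" if "c > 0" for c x
  proof (rule antisym)
    have "p (inverse c *\<^sub>R c *\<^sub>R x) \<le> inverse c * p (c *\<^sub>R x)"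
      using that by (intro scale) auto
    then show "c * p x \<le> p (c *\<^sub>R x)"
      using that by (simp add: field_simps)
  qed (use scale that in auto)
  ultimately show ?thesis
    unfolding sublinear_def using add by (metis less_eq_real_def mult_zero_left scaleR_zero_left)
qed

context
  fixes p :: "'a::real_vector \<Rightarrow> real"
  assumes p: "sublinear p"
begin

lemma sublinear_add: "p (x + y) \<le> p x + p y"
  using p by (simp add: sublinear_def)

lemma sublinear_scale: "c \<ge> 0 \<Longrightarrow> p (c *\<^sub>R x) = c * p x"
  using p by (simp add: sublinear_def)

lemma sublinear_zero: "p 0 = 0"
  using sublinear_scale[of 0 0] by simp

lemma sublinear_minus: "- p (- x) \<le> p x"
  using sublinear_add[of x "- x"] sublinear_zero by simp

end

text \<open>Supplies the bounds of chains for Zorn's lemma. Every member is at least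
  \<open>- p (- x)\<close> at \<open>x\<close>, so the pointwise infimum is finite.\<close>

lemma sublinear_INF_chain:
  assumes "C \<noteq> {}"
    and sub: "\<And>q. q \<in> C \<Longrightarrow> sublinear q"
    and le: "\<And>q. q \<in> C \<Longrightarrow> q \<le> p"
    and chain: "\<And>q r. q \<in> C \<Longrightarrow> r \<in> C \<Longrightarrow> q \<le> r \<or> r \<le> q"
  shows "sublinear (\<lambda>x. INF q\<in>C. q x)"
    and "\<And>q. q \<in> C \<Longrightarrow> (\<lambda>x. INF q\<in>C. q x) \<le> q"
proof -
  have bdd: "bdd_below ((\<lambda>q. q x) ` C)" for x
  proof (rule bdd_belowI2)
    fix q assume "q \<in> C"
    then show "- p (- x) \<le> q x"
      using sublinear_minus[OF sub, of q x] le[of q] by (force dest: le_funD[of _ _ "- x"])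
  qed
  have low: "(INF q\<in>C. q x) \<le> q x" if "q \<in> C" for q x
    using bdd that by (rule cINF_lower)
  then show "\<And>q. q \<in> C \<Longrightarrow> (\<lambda>x. INF q\<in>C. q x) \<le> q"
    by (simp add: le_fun_def)
  show "sublinear (\<lambda>x. INF q\<in>C. q x)"
  proof (rule sublinearI)
    fix x y
    have "(INF q\<in>C. q (x + y)) \<le> q x + r y" if qr: "q \<in> C" "r \<in> C" for q r
    proof -
      \<comment> \<open>Comparability enters here: the smaller of \<open>q\<close> and
        \<open>r\<close> serves at both points.\<close>
      obtain s where "s \<in> C" "s \<le> q" "s \<le> r"
        using chain[OF qr] qr by auto
      then show ?thesis
        using low[of s "x + y"] sublinear_add[OF sub, of s x y] le_funD[of s q x] le_funD[of s r y]
        by simp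
    qed
    then have "(INF q\<in>C. q (x + y)) - r y \<le> (INF q\<in>C. q x)" if "r \<in> C" for r
      using that by (intro cINF_greatest \<open>C \<noteq> {}\<close>) (simp add: algebra_simps)
    then have "(INF q\<in>C. q (x + y)) - (INF q\<in>C. q x) \<le> (INF q\<in>C. q y)"
      by (intro cINF_greatest \<open>C \<noteq> {}\<close>) (simp add: algebra_simps)
    then show "(INF q\<in>C. q (x + y)) \<le> (INF q\<in>C. q x) + (INF q\<in>C. q y)"
      by simp
  next
    fix c :: real and x assume "c > 0"
    have "(INF q\<in>C. q (c *\<^sub>R x)) / c \<le> (INF q\<in>C. q x)"
    proof (rule cINF_greatest[OF \<open>C \<noteq> {}\<close>])
      fix q assume "q \<in> C"
      then show "(INF q\<in>C. q (c *\<^sub>R x)) / c \<le> q x"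
        using low[of q "c *\<^sub>R x"] sublinear_scale[OF sub, of q c x] \<open>c > 0\<close>
        by (simp add: field_simps)
    qed
    then show "(INF q\<in>C. q (c *\<^sub>R x)) \<le> c * (INF q\<in>C. q x)"
      using \<open>c > 0\<close> by (simp add: field_simps)
  qed
qed

text \<open>The witness is the infimum of \<open>p (x + t *\<^sub>R y) - t * p y\<close> over t
  \<ge> 0; the values t = 0 and t = 1 give the two upper bounds.\<close>

lemma sublinear_lower_along:
  assumes "sublinear p"
  obtains q where "sublinear q" "q \<le> p" "\<And>x. q x \<le> p (x + y) - p y"
proof -
  let ?g = "\<lambda>x t. p (x + t *\<^sub>R y) - t * p y"
  define q where "q x = (INF t\<in>{0..}. ?g x t)" for x
  have bdd: "bdd_below (?g x ` {0..})" for x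
  proof (rule bdd_belowI2)
    fix t :: real assume "t \<in> {0..}"
    then show "- p (- x) \<le> ?g x t"
      using sublinear_add[OF assms, of "x + t *\<^sub>R y" "- x"] sublinear_scale[OF assms, of t y] by simp
  qed
  have low: "q x \<le> ?g x t" if "t \<ge> 0" for x t
    unfolding q_def using that by (intro cINF_lower bdd) auto
  have "sublinear q"
  proof (rule sublinearI)
    fix x x'
    \<comment> \<open>The parameter \<open>s + t\<close> splits into \<open>s\<close> for the first
      point and \<open>t\<close> for the second.\<close>
    have *: "q (x + x') \<le> ?g x s + ?g x' t" if "s \<ge> 0" "t \<ge> 0" for s t
      using low[of "s + t" "x + x'"] sublinear_add[OF assms, of "x + s *\<^sub>R y" "x' + t *\<^sub>R y"] that
      by (simp add: algebra_simps)
    have "q (x + x') - ?g x' t \<le> q x" if "t \<ge> 0" for t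
      unfolding q_def[of x] by (rule cINF_greatest) (use * that in \<open>auto simp: algebra_simps\<close>)
    then have "q (x + x') - q x \<le> q x'"
      unfolding q_def[of x'] by (intro cINF_greatest) (auto simp: algebra_simps)
    then show "q (x + x') \<le> q x + q x'" by simp
  next
    fix c :: real and x assume "c > 0"
    \<comment> \<open>Scaling the point by \<open>c\<close> turns the parameter \<open>t\<close>
      into \<open>c * t\<close>.\<close>
    have "q (c *\<^sub>R x) / c \<le> ?g x t" if "t \<ge> 0" for t
    proof -
      have "q (c *\<^sub>R x) \<le> p (c *\<^sub>R (x + t *\<^sub>R y)) - c * t * p y"
        using low[of "c * t" "c *\<^sub>R x"] \<open>c > 0\<close> that by (simp add: algebra_simps)
      also have "\<dots> = c * ?g x t"
        using sublinear_scale[OF assms, of c "x + t *\<^sub>R y"] \<open>c > 0\<close>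
        by (simp only: less_imp_le right_diff_distrib mult.assoc)
      finally show ?thesis
        using \<open>c > 0\<close> by (simp add: field_simps)
    qed
    then have "q (c *\<^sub>R x) / c \<le> q x"
      unfolding q_def[of x] by (intro cINF_greatest) auto
    then show "q (c *\<^sub>R x) \<le> c * q x"
      using \<open>c > 0\<close> by (simp add: field_simps)
  qed
  moreover have "q \<le> p"
    using low[of 0] by (simp add: le_fun_def)
  moreover have "q x \<le> p (x + y) - p y" for x
    using low[of 1] by simp
  ultimately show ?thesis by (rule that)
qed

text \<open>A minimal sublinear functional below \<open>p\<close> is linear, since lowering it along any direction
  cannot change it.\<close>

lemma sublinear_dominates_linear:
  assumes p: "sublinear p"
  obtains f where "linear f" "f \<le> p"
proof -
  define S where "S = {q. sublinear q \<and> q \<le> p}"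
  \<comment> \<open>The order is reversed, so the maximal element from Zorn's lemma is a minimal
    functional.\<close>
  have "\<exists>f\<in>S. \<forall>q\<in>S. q \<le> f \<longrightarrow> q = f"
  proof (rule predicate_Zorn)
    show "partial_order_on S (relation_of (\<lambda>q r. r \<le> q) S)"
      by (rule partial_order_on_relation_ofI) auto
  next
    fix C assume "C \<in> Chains (relation_of (\<lambda>q r. r \<le> q) S)"
    then have C: "C \<subseteq> S" and chain: "\<And>q r. q \<in> C \<Longrightarrow> r \<in> C \<Longrightarrow> q \<le> r \<or> r \<le> q"
      unfolding Chains_def relation_of_def by auto
    show "\<exists>u\<in>S. \<forall>q\<in>C. u \<le> q"
    proof (cases "C = {}")
      \<comment> \<open>The infimum over an empty chain says nothing, so \<open>p\<close> itself is
        the bound.\<close>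
      case True
      then show ?thesis using p by (auto simp: S_def)
    next
      case False
      note INF = sublinear_INF_chain[OF False, of p]
      have "sublinear (\<lambda>x. INF q\<in>C. q x)"
        by (rule INF) (use C chain in \<open>auto simp: S_def\<close>)
      moreover have "(\<lambda>x. INF q\<in>C. q x) \<le> q" if "q \<in> C" for q
        by (rule INF) (use C chain that in \<open>auto simp: S_def\<close>)
      moreover from this have "(\<lambda>x. INF q\<in>C. q x) \<le> p"
        using False C by (force simp: S_def intro: order_trans)
      ultimately show ?thesis
        by (auto simp: S_def)
    qed
  qed
  then obtain f where f: "sublinear f" "f \<le> p"
    and min: "\<And>q. sublinear q \<Longrightarrow> q \<le> p \<Longrightarrow> q \<le> f \<Longrightarrow> q = f"
    by (auto simp: S_def)
  have add: "f (x + y) = f x + f y" for x y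
  proof (rule antisym)
    obtain q where q: "sublinear q" "q \<le> f" "\<And>x. q x \<le> f (x + y) - f y"
      using sublinear_lower_along[OF f(1), of y] by blast
    then have "q = f"
      using f(2) by (intro min) auto
    then show "f x + f y \<le> f (x + y)"
      using q(3)[of x] by simp
  qed (rule sublinear_add[OF f(1)])
  have minus: "f (- x) = - f x" for x
    using add[of x "- x"] sublinear_zero[OF f(1)] by simp
  have "f (c *\<^sub>R x) = c *\<^sub>R f x" for c x
  proof (cases "c \<ge> 0")
    case False
    then have "f ((- c) *\<^sub>R x) = - c * f x"
      by (intro sublinear_scale[OF f(1)]) simp
    then show ?thesis by (simp add: minus)
  qed (simp add: sublinear_scale[OF f(1)])
  then have "linear f"
    using add by (intro linearI)
  then show ?thesis using f(2) by (rule that)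
qed

text \<open>Lowering \<open>p\<close> along \<open>y\<close> first gives
  \<open>q (- y) \<le> - p y\<close>. Any linear functional below \<open>q\<close> inherits this,
  which by linearity is the missing inequality at \<open>y\<close>.\<close>

theorem hahn_banach_sublinear:
  assumes "sublinear p"
  obtains f where "linear f" "f \<le> p" "f y = p y"
proof -
  obtain q where q: "sublinear q" "q \<le> p" "\<And>x. q x \<le> p (x + y) - p y"
    using sublinear_lower_along[OF assms, of y] by blast
  obtain f where f: "linear f" "f \<le> q"
    using sublinear_dominates_linear[OF q(1)] by blast
  have "f (- y) \<le> - p y"
    using q(3)[of "- y"] sublinear_zero[OF assms] f(2) by (force dest: le_funD[of _ _ "- y"])
  then have "p y \<le> f y"
    by (simp add: linear_neg[OF f(1)])
  moreover have "f \<le> p" using f(2) q(2) by (rule order_trans)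
  ultimately show ?thesis
    using f(1) that by (metis antisym le_funD)
qed

section \<open>Separation of a point from a closed convex cone\<close>

text \<open>Sums and positive multiples of approximating points stay in \<open>K\<close>, so they
  compete in the distance of the sum or multiple.\<close>

lemma sublinear_infdist_convex_cone:
  fixes K :: "'a::real_normed_vector set"
  assumes "convex K" "cone K" "K \<noteq> {}"
  shows "sublinear (\<lambda>x. infdist x K)"
proof (rule sublinearI)
  fix x y
  have *: "infdist (x + y) K \<le> dist x a + dist y b" if "a \<in> K" "b \<in> K" for a b
  proof -
    have "a + b \<in> K"
      using that assms convex_cone by blast
    then have "infdist (x + y) K \<le> dist (x + y) (a + b)"
      by (rule infdist_le)
    also have "\<dots> \<le> dist x a + dist y b"
      by (rule dist_triangle_add)
    finally show ?thesis .
  qed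
  have "infdist (x + y) K - dist y b \<le> infdist x K" if "b \<in> K" for b
    unfolding infdist_notempty[OF \<open>K \<noteq> {}\<close>, of x]
    using *[OF _ that] by (intro cINF_greatest \<open>K \<noteq> {}\<close>) (simp add: algebra_simps)
  then have "infdist (x + y) K - infdist x K \<le> infdist y K"
    unfolding infdist_notempty[OF \<open>K \<noteq> {}\<close>, of y]
    by (intro cINF_greatest \<open>K \<noteq> {}\<close>) (simp add: algebra_simps)
  then show "infdist (x + y) K \<le> infdist x K + infdist y K"
    by simp
next
  fix c :: real and x assume "c > 0"
  have "infdist (c *\<^sub>R x) K / c \<le> infdist x K"
    unfolding infdist_notempty[OF \<open>K \<noteq> {}\<close>, of x]
  proof (rule cINF_greatest[OF \<open>K \<noteq> {}\<close>])
    fix a assume "a \<in> K"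
    then have "infdist (c *\<^sub>R x) K \<le> dist (c *\<^sub>R x) (c *\<^sub>R a)"
      using \<open>cone K\<close> \<open>c > 0\<close> by (intro infdist_le) (simp add: cone_def)
    moreover have "dist (c *\<^sub>R x) (c *\<^sub>R a) = c * dist x a"
      using \<open>c > 0\<close> by (simp add: dist_norm flip: scaleR_diff_right)
    ultimately show "infdist (c *\<^sub>R x) K / c \<le> dist x a"
      using \<open>c > 0\<close> by (simp add: field_simps)
  qed
  then show "infdist (c *\<^sub>R x) K \<le> c * infdist x K"
    using \<open>c > 0\<close> by (simp add: field_simps)
qed

text \<open>A linear functional below the distance to \<open>K\<close>, with equality at
  \<open>w\<close>, is nonpositive on \<open>K\<close>, positive at \<open>w\<close> since
  \<open>K\<close> is closed, and at most the norm since \<open>K\<close> contains 0. Its negative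
  separates.\<close>

lemma separate_point_closed_convex_cone:
  fixes K :: "'a::real_normed_vector set"
  assumes "closed K" "convex K" "cone K" "K \<noteq> {}" "w \<notin> K"
  obtains f :: "'a \<Rightarrow> real" where "bounded_linear f" "\<And>x. \<bar>f x\<bar> \<le> norm x"
    "\<And>k. k \<in> K \<Longrightarrow> f k \<ge> 0" "f w < 0"
proof -
  obtain g where g: "linear g" "g \<le> (\<lambda>x. infdist x K)" "g w = infdist w K"
    using hahn_banach_sublinear[OF sublinear_infdist_convex_cone[OF assms(2-4)]] by blast
  have "0 \<in> K"
    using assms(3,4) cone_contains_0 by blast
  then have "g x \<le> norm x" for x
    using le_funD[OF g(2), of x] infdist_le[of 0 K x] by simp
  from this[of "- x" for x] this have bound: "\<bar>- g x\<bar> \<le> norm x" for x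
    by (simp add: abs_le_iff linear_neg[OF g(1)])
  show ?thesis
  proof
    show "bounded_linear (\<lambda>x. - g x)"
      by (rule bounded_linear_intro[where K = 1])
        (use bound in \<open>auto simp: linear_add[OF g(1)] linear_scale[OF g(1)]\<close>)
    show "\<bar>- g x\<bar> \<le> norm x" for x by (rule bound)
    show "0 \<le> - g k" if "k \<in> K" for k
      using le_funD[OF g(2), of k] that by simp
    have "infdist w K > 0"
      using assms(1,4,5) by (rule infdist_pos_not_in_closed)
    then show "- g w < 0" using g(3) by simp
  qed
qed

section \<open>Weakly cone-compact sets and subgradients\<close>

text \<open>The half-spaces f > -n are weakly open and cover everything. Adding \<open>K\<close>
  cannot lower \<open>f\<close>, so the largest index in a finite subcover gives a bound.\<close>

lemma weakly_K_compact_bdd_below: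
  assumes "weakly_K_compact K A" "0 \<in> K" "bounded_linear f" "\<And>k. k \<in> K \<Longrightarrow> f k \<ge> (0::real)"
  shows "bdd_below (f ` A)"
proof -
  define H where "H n = f -` {- real n<..}" for n
  have "openin weak_topology (H n)" for n
    unfolding weak_topology_def H_def
    by (rule topology_generated_by_Basis)
      (auto intro!: exI[of _ f] exI[of _ "{- real n<..}"] assms(3))
  moreover have "A \<subseteq> (\<Union>U\<in>range H. U + K)"
  proof
    fix a
    obtain n where "- f a < real n" using reals_Archimedean2 by blast
    then have "a + 0 \<in> H n + K"
      using assms(2) by (intro set_plus_intro) (auto simp: H_def)
    then show "a \<in> (\<Union>U\<in>range H. U + K)" by auto
  qed
  ultimately obtain \<V> where V: "finite \<V>" "\<V> \<subseteq> range H" "A \<subseteq> (\<Union>U\<in>\<V>. U + K)"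
    using assms(1) unfolding weakly_K_compact_def
    by (metis (no_types, lifting) imageE)
  then obtain N where N: "finite N" "\<V> = H ` N"
    using finite_subset_image by (metis subset_UNIV)
  show ?thesis
  proof (rule bdd_belowI2)
    fix a assume "a \<in> A"
    then obtain n h k where nhk: "n \<in> N" "a = h + k" "h \<in> H n" "k \<in> K"
      using V N by (auto simp: set_plus_def)
    then have "f a \<ge> - real n"
      using assms(4)[of k] by (simp add: H_def bounded_linear.linear[OF assms(3)] linear_add)
    moreover have "n \<le> Max N" using N nhk by simp
    ultimately show "- real (Max N) \<le> f a" by linarith
  qed
qed

lemma excess_less_obtain:
  assumes "excess A B < ennreal r" "x \<in> A"
  obtains y where "y \<in> B" "dist x y < r"
proof -
  have "(INF y\<in>B. ennreal (dist x y)) \<le> excess A B"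
    unfolding excess_def using assms(2) by (rule SUP_upper)
  then have "(INF y\<in>B. ennreal (dist x y)) < ennreal r"
    using assms(1) by (rule le_less_trans)
  then show ?thesis
    using that by (auto simp: INF_less_iff ennreal_less_iff)
qed

lemma frechet_subdifferential_approx:
  assumes "T \<in> frechet_subdifferential K F zbar" "\<epsilon> > 0"
  shows "\<forall>\<^sub>F z in at zbar. \<forall>x\<in>Epi K F z. \<exists>y\<in>Epi K F zbar.
    dist x (y + blinfun_apply T (z - zbar)) < \<epsilon> * norm (z - zbar)"
proof -
  have "\<forall>\<^sub>F z in at zbar. excess (Epi K F z) (Epi K F zbar + {blinfun_apply T (z - zbar)})
      / ennreal (norm (z - zbar)) < ennreal \<epsilon>"
    using assms unfolding frechet_subdifferential_def by (intro order_tendstoD(2)) auto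
  \<comment> \<open>Away from \<open>zbar\<close> the denominator is positive and can be multiplied
    across.\<close>
  moreover have "\<forall>\<^sub>F z in at zbar. z \<noteq> zbar"
    by (simp add: eventually_at_filter)
  ultimately show ?thesis
  proof eventually_elim
    case (elim z)
    have "excess (Epi K F z) (Epi K F zbar + {blinfun_apply T (z - zbar)})
        < ennreal (\<epsilon> * norm (z - zbar))"
      using elim assms(2) by (simp add: divide_less_ennreal ennreal_mult'')
    then show ?case
      by (auto simp: set_plus_def elim!: excess_less_obtain)
  qed
qed

lemma subgradient_order_bound:
  fixes K :: "'x::real_normed_vector set"
    and F :: "'z::real_normed_vector \<Rightarrow> 'x set"
  assumes K: "closed K" "convex K" "cone K"
    and lip: "K_Lipschitz_around K F zbar l e"
    and compact: "weakly_K_compact K (F zbar)"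
    and T: "T \<in> frechet_subdifferential K F zbar"
    and u: "norm u = 1"
  shows "l *\<^sub>R e - blinfun_apply T u \<in> K"
proof (rule ccontr)
  let ?w = "l *\<^sub>R e - blinfun_apply T u"
  assume "?w \<notin> K"
  obtain U where U: "open U" "zbar \<in> U"
    and FU: "\<And>z' z''. z' \<in> U \<Longrightarrow> z'' \<in> U \<Longrightarrow> F z'' + {(l * norm (z'' - z')) *\<^sub>R e} \<subseteq> F z' + K"
    and "K \<noteq> {}"
    using lip unfolding K_Lipschitz_around_def by blast
  obtain f where f: "bounded_linear f" "\<And>x. \<bar>f x\<bar> \<le> norm x" "\<And>k. k \<in> K \<Longrightarrow> f k \<ge> (0::real)"
    and fw: "f ?w < 0"
    using separate_point_closed_convex_cone[OF K \<open>K \<noteq> {}\<close> \<open>?w \<notin> K\<close>] by blast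
  note lin = bounded_linear.linear[OF f(1)]
  note f_simps = linear_add[OF lin] linear_diff[OF lin] linear_scale[OF lin]
  have "0 \<in> K" using \<open>K \<noteq> {}\<close> K(3) cone_contains_0 by blast
  define A where "A = F zbar"
  define m where "m = (INF a\<in>A. f a)"
  have "A \<noteq> {}" using compact by (simp add: A_def weakly_K_compact_def)
  have "bdd_below (f ` A)"
    unfolding A_def using compact \<open>0 \<in> K\<close> f(1,3) by (rule weakly_K_compact_bdd_below)
  then have m: "m \<le> f a" if "a \<in> A" for a
    unfolding m_def using that by (rule cINF_lower)
  \<comment> \<open>Half the gap: moving by \<open>t *\<^sub>R ?w\<close> changes \<open>f\<close>
    by \<open>- 2 * \<epsilon> * t\<close>, and an error below \<open>\<epsilon> * t\<close> still
    leaves a gain of \<open>\<epsilon> * t\<close>.\<close>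
  define \<epsilon> where "\<epsilon> = - f ?w / 2"
  have "\<epsilon> > 0" using fw by (simp add: \<epsilon>_def)
  have "\<forall>\<^sub>F z in at zbar. z \<in> U"
    using U by (simp add: eventually_at_topological) blast
  with frechet_subdifferential_approx[OF T \<open>\<epsilon> > 0\<close>]
  have "\<forall>\<^sub>F z in at zbar. z \<in> U \<and> (\<forall>x\<in>Epi K F z. \<exists>y\<in>Epi K F zbar.
      dist x (y + blinfun_apply T (z - zbar)) < \<epsilon> * norm (z - zbar))"
    by eventually_elim blast
  then obtain d where "d > 0" and d: "\<And>z. z \<noteq> zbar \<Longrightarrow> dist z zbar < d \<Longrightarrow> z \<in> U \<and>
      (\<forall>x\<in>Epi K F z. \<exists>y\<in>Epi K F zbar.
        dist x (y + blinfun_apply T (z - zbar)) < \<epsilon> * norm (z - zbar))"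
    unfolding eventually_at by blast
  define t where "t = d / 2"
  define z where "z = zbar + t *\<^sub>R u"
  have t: "t > 0" "z \<noteq> zbar" "dist z zbar < d" "norm (z - zbar) = t" "norm (zbar - z) = t"
    using \<open>d > 0\<close> u by (auto simp: t_def z_def dist_norm)
  have "m + t * \<epsilon> \<le> f a" if "a \<in> A" for a
  proof -
    \<comment> \<open>The Lipschitz inclusion is used from \<open>zbar\<close> to \<open>z\<close>,
      the subgradient inequality then leads back to \<open>zbar\<close>.\<close>
    have "a + (l * t) *\<^sub>R e \<in> F zbar + {(l * norm (zbar - z)) *\<^sub>R e}"
      using that t(5) by (auto simp: A_def)
    then have "a + (l * t) *\<^sub>R e \<in> Epi K F z"
      using FU[of z zbar] d[OF t(2,3)] U(2) by (auto simp: Epi_def)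
    then obtain y where y: "y \<in> Epi K F zbar"
      "norm (a + (l * t) *\<^sub>R e - (y + blinfun_apply T (z - zbar))) < \<epsilon> * t"
      using d[OF t(2,3)] t(4) by (auto simp: dist_norm)
    then obtain b k where b: "y = b + k" "b \<in> A" "k \<in> K"
      by (auto simp: Epi_def A_def set_plus_def)
    \<comment> \<open>The Lipschitz shift and the subgradient shift, both of size \<open>t\<close>,
      combine into \<open>t *\<^sub>R ?w\<close>.\<close>
    have "a + (l * t) *\<^sub>R e - (y + blinfun_apply T (z - zbar)) = a + t *\<^sub>R ?w - b - k"
      by (simp add: b(1) z_def blinfun.scaleR_right algebra_simps)
    then have "norm (a + t *\<^sub>R ?w - b - k) < \<epsilon> * t"
      using y(2) by (simp only:)
    then have "f (a + t *\<^sub>R ?w - b - k) > - (\<epsilon> * t)"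
      using f(2)[of "a + t *\<^sub>R ?w - b - k"] by linarith
    then have "f a + t * f ?w - f b - f k > - (\<epsilon> * t)"
      by (simp only: f_simps real_scaleR_def)
    moreover have "t * f ?w = - 2 * (\<epsilon> * t)" by (simp add: \<epsilon>_def)
    ultimately show ?thesis
      using m[OF b(2)] f(3)[OF b(3)] by (simp add: mult.commute)
  qed
  \<comment> \<open>The infimum over \<open>a\<close> on the right-hand side is \<open>m\<close>
    again.\<close>
  then have "m + t * \<epsilon> \<le> m"
    unfolding m_def[symmetric] by (subst (2) m_def) (intro cINF_greatest \<open>A \<noteq> {}\<close>)
  then show False
    using mult_pos_pos[OF t(1) \<open>\<epsilon> > 0\<close>] by simp
qed

section \<open>The norm bound from normality\<close>

theorem proposition3p13:
  fixes K :: "'x::real_normed_vector set"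
    and F :: "'z::real_normed_vector \<Rightarrow> 'x set"
    and zbar :: 'z and l :: real and e :: 'x
  assumes "closed K" and "convex K" and "cone K" and "pointed K"
    and "K_Lipschitz_around K F zbar l e"
    and "\<And>z. weakly_K_compact K (F z)"
    and "normal_cone K"
  shows "\<exists>\<alpha>>0. \<forall>T \<in> frechet_subdifferential K F zbar.
           \<forall>u \<in> sphere 0 1 \<inter> blinfun_apply T -` (K \<union> uminus ` K).
             norm (blinfun_apply T u) \<le> \<alpha> * l * norm e"
proof -
  \<comment> \<open>The constant depends on \<open>K\<close> alone, hence is uniform in
    \<open>T\<close> and \<open>u\<close>.\<close>
  obtain \<alpha> where "\<alpha> > 0"
    and \<alpha>: "\<And>z y. z \<in> K \<Longrightarrow> y \<in> K \<Longrightarrow> y - z \<in> K \<Longrightarrow> norm z \<le> \<alpha> * norm y"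
    using assms(7) unfolding normal_cone_def by blast
  have "l > 0" "e \<in> K"
    using assms(5) by (auto simp: K_Lipschitz_around_def)
  then have le: "l *\<^sub>R e \<in> K"
    using assms(3) by (simp add: cone_def)
  \<comment> \<open>Normality is applied to \<open>blinfun_apply T u\<close> and
    \<open>l *\<^sub>R e\<close>, whose difference lies in \<open>K\<close> by
    \<open>subgradient_order_bound\<close>.\<close>
  have bound: "norm (blinfun_apply T u) \<le> \<alpha> * l * norm e"
    if "T \<in> frechet_subdifferential K F zbar" "norm u = 1" "blinfun_apply T u \<in> K" for T u
    using \<alpha>[OF that(3) le subgradient_order_bound[OF assms(1-3,5,6) that(1,2)]] \<open>l > 0\<close>
    by (simp add: mult.assoc)
  have "norm (blinfun_apply T u) \<le> \<alpha> * l * norm e"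
    if T: "T \<in> frechet_subdifferential K F zbar"
      and u: "u \<in> sphere 0 1 \<inter> blinfun_apply T -` (K \<union> uminus ` K)" for T u
  proof (cases "blinfun_apply T u \<in> K")
    case True
    then show ?thesis using T u by (intro bound) auto
  next
    case False
    then have "blinfun_apply T (- u) \<in> K"
      using u by (auto simp: blinfun.minus_right)
    then show ?thesis
      using bound[OF T, of "- u"] u by (simp add: blinfun.minus_right)
  qed
  then show ?thesis using \<open>\<alpha> > 0\<close> by blast
qed

end
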